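(* Let $n\ge 3$ and let $\mathcal E_n=\{\mathcal E_{n,h}: h\in\{0,1,\ldots,n\}\}$. Every ordering in $\mathcal E_n$ is essential, and no ordering in $\mathcal S_n\setminus\mathcal E_n$ is essential.
   Context: A matrix chain of length $n$ is a product $M_1 M_2 \cdots M_n$ where $M_i$ has size $k_{i-1}\times k_i$; an instance is a tuple $\boldsymbol k=(k_0,k_1,\ldots,k_n)$ of positive integers. $\mathcal S_n$ denotes the set of all (full) parenthesisations (called orderings) of $M_1\cdots M_n$. Each of the $n-1$ multiplications in an ordering multiplies $(M_{a+1}\cdots M_b)$ by $(M_{b+1}\cdots M_c)$ for some $0\le a<b<c\le n$ at cost $k_a k_b k_c$; the cost $T(\mathcal A,\boldsymbol k)$ of an ordering is the sum of the costs of its $n-1$ multiplications. For a proper subset $\mathcal Q\subsetneq \mathcal S_n$, the penalty of removing $\mathcal Q$ on instance $\boldsymbol k$ is $$P(\mathcal Q,\boldsymbol k)=\frac{\min_{\mathcal B\in\mathcal S_n\setminus\mathcal Q}T(\mathcal B,\boldsymbol k)}{\min_{\mathcal A\in\mathcal S_n}T(\mathcal A,\boldsymbol k)}-1.$$ An ordering $\mathcal A$ is essential if for every $r\in\mathbb R^+$ there exists an instance $\boldsymbol k$ with $P(\{\mathcal A\},\boldsymbol k)>r$. For $h\in\{0,1,\ldots,n\}$, $\mathcal E_{n,h}$ is the ordering $L_h R_h$, where $L_h=(M_1(M_2(\cdots(M_{h-1}M_h)\cdots)))$ is the right-to-left product of $M_1,\ldots,M_h$, $R_h=((\cdots(M_{h+1}M_{h+2})\cdots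 M_{n-1})M_n)$ is the left-to-right product of $M_{h+1},\ldots,M_n$, and an empty product ($h=0$ or $h=n$) is omitted. *)

theory Defs
  imports Complex_Main
begin

text \<open>
  \<open>Mat i\<close> is the single matrix \<open>M\<^sub>i\<close>; \<open>Mult A B\<close> is the parenthesised product \<open>(A B)\<close>.
\<close>

datatype ordering = Mat nat | Mult ordering ordering

fun factors :: "ordering \<Rightarrow> nat list" where
  "factors (Mat i) = [i]"
| "factors (Mult A B) = factors A @ factors B"

definition orderings :: "nat \<Rightarrow> ordering set" where
  "orderings n = {A. factors A = [1..<Suc n]}"

text \<open>
  The list \<open>k = [k\<^sub>0, \<dots>, k\<^sub>n]\<close> gives the dimensions: \<open>M\<^sub>i\<close> has size \<open>k ! (i - 1) \<times> k ! i\<close>.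
\<close>

definition chain_instance :: "nat \<Rightarrow> nat list \<Rightarrow> bool" where
  "chain_instance n k \<longleftrightarrow> length k = Suc n \<and> (\<forall>i\<le>n. 0 < k ! i)"

text \<open>
  When \<open>A\<close> is the product \<open>M\<^bsub>a+1\<^esub> \<dots> M\<^sub>b\<close> and \<open>B\<close> the product \<open>M\<^bsub>b+1\<^esub> \<dots> M\<^sub>c\<close>, multiplying \<open>A\<close> by \<open>B\<close>
  contributes the summand \<open>k\<^sub>a k\<^sub>b k\<^sub>c\<close>.
\<close>

fun cost :: "ordering \<Rightarrow> nat list \<Rightarrow> nat" where
  "cost (Mat i) k = 0"
| "cost (Mult A B) k =
     cost A k + cost B k
     + k ! (hd (factors A) - 1) * k ! last (factors A) * k ! last (factors B)"

definition min_cost :: "ordering set \<Rightarrow> nat list \<Rightarrow> nat" where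
  "min_cost S k = Min ((\<lambda>A. cost A k) ` S)"

definition penalty :: "nat \<Rightarrow> ordering set \<Rightarrow> nat list \<Rightarrow> real" where
  "penalty n Q k = real (min_cost (orderings n - Q) k) / real (min_cost (orderings n) k) - 1"

definition essential :: "nat \<Rightarrow> ordering \<Rightarrow> bool" where
  "essential n A \<longleftrightarrow>
     A \<in> orderings n \<and> (\<forall>r::real. r > 0 \<longrightarrow> (\<exists>k. chain_instance n k \<and> penalty n {A} k > r))"

text \<open>
  \<open>L_ord h\<close> is \<open>(M\<^sub>1 (M\<^sub>2 (\<dots> (M\<^bsub>h-1\<^esub> M\<^sub>h) \<dots>)))\<close> and is meant for \<open>h \<ge> 1\<close>;
  \<open>R_ord n h\<close> is \<open>((\<dots> (M\<^bsub>h+1\<^esub> M\<^bsub>h+2\<^esub>) \<dots> M\<^bsub>n-1\<^esub>) M\<^sub>n)\<close> and is meant for \<open>h < n\<close>.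
\<close>

definition L_ord :: "nat \<Rightarrow> ordering" where
  "L_ord h = foldr (\<lambda>i A. Mult (Mat i) A) [1..<h] (Mat h)"

definition R_ord :: "nat \<Rightarrow> nat \<Rightarrow> ordering" where
  "R_ord n h = foldl (\<lambda>A i. Mult A (Mat i)) (Mat (h + 1)) [h + 2..<Suc n]"

definition E_ord :: "nat \<Rightarrow> nat \<Rightarrow> ordering" where
  "E_ord n h = (if h = 0 then R_ord n 0 else if h = n then L_ord n else Mult (L_ord h) (R_ord n h))"

definition E_set :: "nat \<Rightarrow> ordering set" where
  "E_set n = {E_ord n h | h. h \<le> n}"

text \<open>
  The minima in \<^const>\<open>min_cost\<close> are taken over finite nonempty sets: \<^term>\<open>orderings n\<close> is finite,
  and for \<open>n \<ge> 3\<close> it has a member other than any given ordering.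
\<close>

lemma factors_nonempty: "factors A \<noteq> []"
  by (induction A) auto

lemma finite_factors: "finite {A. factors A = xs}"
proof (induction "length xs" arbitrary: xs rule: less_induct)
  case less
  let ?I = "{1..<length xs}"
  have "{A. factors A = xs} \<subseteq> Mat ` set xs \<union>
    (\<Union>i\<in>?I. case_prod Mult ` ({A. factors A = take i xs} \<times> {A. factors A = drop i xs}))"
    (is "_ \<subseteq> ?U")
  proof
    fix A assume "A \<in> {A. factors A = xs}"
    then have A: "factors A = xs" by simp
    show "A \<in> ?U"
    proof (cases A)
      case (Mat i)
      then show ?thesis using A by auto
    next
      case (Mult B C)
      let ?i = "length (factors B)"
      have "?i \<in> ?I" "factors B = take ?i xs" "factors C = drop ?i xs"
        using A Mult factors_nonempty[of B] factors_nonempty[of C]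
        by (auto simp: Suc_le_eq)
      then show ?thesis using Mult by force
    qed
  qed
  moreover have "finite ?U"
    using less by (intro finite_UnI finite_imageI finite_UN_I finite_cartesian_product) auto
  ultimately show ?case by (rule finite_subset)
qed

lemma finite_orderings: "finite (orderings n)"
  unfolding orderings_def by (rule finite_factors)

lemma factors_L_ord: "h \<ge> 1 \<Longrightarrow> factors (L_ord h) = [1..<Suc h]"
proof -
  have "factors (foldr (\<lambda>i A. Mult (Mat i) A) xs B) = xs @ factors B" for xs B
    by (induction xs) auto
  then show "h \<ge> 1 \<Longrightarrow> factors (L_ord h) = [1..<Suc h]" by (simp add: L_ord_def)
qed

lemma factors_R_ord: "h < n \<Longrightarrow> factors (R_ord n h) = [Suc h..<Suc n]"
proof -
  have "factors (foldl (\<lambda>A i. Mult A (Mat i)) B xs) = factors B @ xs" for xs B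
    by (induction xs arbitrary: B) auto
  then show "h < n \<Longrightarrow> factors (R_ord n h) = [Suc h..<Suc n]"
    by (simp add: R_ord_def upt_conv_Cons del: upt_Suc)
qed

lemma E_set_subset_orderings:
  assumes "n \<ge> 1" shows "E_set n \<subseteq> orderings n"
proof -
  have "factors (E_ord n h) = [1..<Suc n]" if "h \<le> n" for h
  proof -
    have "[1..<Suc h] @ [Suc h..<Suc n] = [1..<Suc n]"
      using upt_add_eq_append[of 1 "Suc h" "n - h"] that by simp
    then show ?thesis
      using that assms by (auto simp: E_ord_def factors_L_ord factors_R_ord simp del: upt_Suc)
  qed
  then show ?thesis by (auto simp: E_set_def orderings_def)
qed

lemma orderings_remove1_nonempty:
  assumes "n \<ge> 3" shows "orderings n - {A} \<noteq> {}"
proof -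
  have "R_ord n 0 \<noteq> Mult (L_ord 1) (R_ord n 1)"
  proof
    assume eq: "R_ord n 0 = Mult (L_ord 1) (R_ord n 1)"
    have "R_ord n 0 = Mult (foldl (\<lambda>A i. Mult A (Mat i)) (Mat 1) [2..<n]) (Mat n)"
      using assms by (simp add: R_ord_def numeral_2_eq_2)
    with eq have "R_ord n 1 = Mat n" by simp
    then have "[Suc 1..<Suc n] = [n]" using factors_R_ord[of 1 n] assms by simp
    then show False using assms by (auto dest: arg_cong[where f = length])
  qed
  moreover have "R_ord n 0 = E_ord n 0" "Mult (L_ord 1) (R_ord n 1) = E_ord n 1"
    using assms by (auto simp: E_ord_def)
  ultimately have "E_ord n 0 \<noteq> E_ord n 1" by simp
  moreover have "E_ord n h \<in> orderings n" if "h \<le> n" for h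
    using E_set_subset_orderings[of n] that assms by (auto simp: E_set_def)
  then have "E_ord n 0 \<in> orderings n" "E_ord n 1 \<in> orderings n"
    using assms by auto
  ultimately show ?thesis by (metis Diff_iff empty_iff singletonD)
qed

end

theory Submission imports Defs begin

text \<open>
  Orderings of \<open>M\<^sub>1 \<dots> M\<^sub>n\<close> correspond to triangulations of the polygon with vertices \<open>0, \<dots>, n\<close>, and
  \<open>E_ord n h\<close> is the fan of all diagonals at \<open>h\<close>. If \<open>k\<^sub>h = 1\<close> and all other dimensions are \<open>x\<close>,
  the fan costs at most \<open>n x\<^sup>2\<close>, whereas any other ordering has a triangle avoiding \<open>h\<close> and so
  costs at least \<open>x\<^sup>3\<close>; thus fans are essential. Conversely, every edge of the polygon lies in
  some triangle of a triangulation, so the fan at a vertex of minimal dimension costs at most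
  \<open>n\<close> times as much as any other ordering; thus removing a non-fan has bounded penalty.
\<close>

section \<open>Splitting orderings of a block of consecutive matrices\<close>

text \<open>The list \<open>[Suc a..<Suc c]\<close> stands for the subpolygon on the vertices
  \<open>a\<close>, ..., \<open>c\<close>. The top product is its triangle on \<open>a\<close>,
  \<open>b\<close>, \<open>c\<close>, so later proofs can induct on subpolygons without unfolding
  \<open>hd\<close> and \<open>last\<close>.\<close>

lemma factors_Mult_eq_upt:
  assumes "factors (Mult B C) = [Suc a..<Suc c]"
  obtains b where "a < b" "b < c" "factors B = [Suc a..<Suc b]" "factors C = [Suc b..<Suc c]"
    "cost (Mult B C) k = cost B k + cost C k + k ! a * k ! b * k ! c"
proof -
  define b where "b = a + length (factors B)"
  have len: "length (factors B) + length (factors C) = c - a"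
    using arg_cong[OF assms, of length] by (simp del: upt_Suc)
  have pos: "length (factors B) > 0" "length (factors C) > 0"
    by (simp_all add: factors_nonempty)
  have b: "a < b" "b < c" using len pos unfolding b_def by linarith+
  have "factors B = take (length (factors B)) [Suc a..<Suc c]"
       "factors C = drop (length (factors B)) [Suc a..<Suc c]"
    using assms by (metis append_eq_conv_conj factors.simps(2))+
  then have B: "factors B = [Suc a..<Suc b]" and C: "factors C = [Suc b..<Suc c]"
    using b by (simp_all add: b_def take_upt drop_upt del: upt_Suc)
  have "hd (factors B) = Suc a" "last (factors B) = b" "last (factors C) = c"
    using b unfolding B C by (simp_all add: hd_upt last_upt del: upt_Suc)
  with b B C show thesis by (intro that) auto
qed

lemma factors_Mat_eq_upt:
  assumes "factors (Mat i) = [Suc a..<Suc c]"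
  shows "c = Suc a" "i = c"
proof -
  show c: "c = Suc a" using arg_cong[OF assms, of length] by (simp del: upt_Suc)
  with assms show "i = c" by simp
qed

lemma factors_eq_upt_singleton:
  assumes "factors A = [Suc a..<Suc c]" "c \<le> Suc a"
  shows "A = Mat c"
proof (cases A)
  case (Mat i)
  with assms show ?thesis using factors_Mat_eq_upt by blast
next
  case (Mult B C)
  with assms show ?thesis by (metis factors_Mult_eq_upt Suc_leI leD less_le_trans)
qed

section \<open>Lower bounds from single triangles\<close>

text \<open>Descending into the factor that contains \<open>Mat (Suc i)\<close> ends at a product
  having that matrix itself as a factor. Its triangle has the side from \<open>i\<close> to
  \<open>Suc i\<close>, and its third vertex has dimension at least \<open>m\<close>.\<close>

lemma cost_ge_edge:
  assumes "factors A = [Suc a..<Suc c]" "Suc a < c" "a \<le> i" "i < c"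
    and "\<And>j. a \<le> j \<Longrightarrow> j \<le> c \<Longrightarrow> m \<le> k ! j"
  shows "m * (k ! i * k ! Suc i) \<le> cost A k"
  using assms
proof (induction A arbitrary: a c)
  case (Mat j)
  then show ?case using factors_Mat_eq_upt by blast
next
  case (Mult B C)
  obtain b where b: "a < b" "b < c" "factors B = [Suc a..<Suc b]" "factors C = [Suc b..<Suc c]"
    and cost: "cost (Mult B C) k = cost B k + cost C k + k ! a * k ! b * k ! c"
    using factors_Mult_eq_upt[OF Mult.prems(1)] by metis
  \<comment> \<open>The edge belongs to \<open>B\<close> or to \<open>C\<close>. Either that factor
    is a proper product and induction applies, or it is a single matrix and the top triangle
    contains the edge, with apex \<open>c\<close> or \<open>a\<close>.\<close>
  consider "Suc a < b" "i < b" | "b = Suc a" "i = a" | "Suc b < c" "b \<le> i" | "c = Suc b" "i = b"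
    using b Mult.prems by linarith
  then show ?case
  proof cases
    case 1
    have "m * (k ! i * k ! Suc i) \<le> cost B k"
      using 1 b Mult.prems by (intro Mult.IH(1)) auto
    then show ?thesis using cost by linarith
  next
    case 2
    have "m * (k ! i * k ! Suc i) \<le> k ! c * (k ! i * k ! Suc i)"
      using b Mult.prems by (intro mult_right_mono) auto
    also have "\<dots> = k ! a * k ! b * k ! c" using 2 by simp
    finally show ?thesis using cost by linarith
  next
    case 3
    have "m * (k ! i * k ! Suc i) \<le> cost C k"
      using 3 b Mult.prems by (intro Mult.IH(2)) auto
    then show ?thesis using cost by linarith
  next
    case 4
    have "m * (k ! i * k ! Suc i) \<le> k ! a * (k ! i * k ! Suc i)"
      using b Mult.prems by (intro mult_right_mono) auto
    also have "\<dots> = k ! a * k ! b * k ! c" using 4 by simp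
    finally show ?thesis using cost by linarith
  qed
qed

text \<open>The side from \<open>a\<close> to \<open>c\<close> lies in the triangle of the last
  multiplication, whose third vertex is the split point.\<close>

lemma cost_ge_outer_edge:
  assumes "factors A = [Suc a..<Suc c]" "Suc a < c"
    and "\<And>j. a \<le> j \<Longrightarrow> j \<le> c \<Longrightarrow> m \<le> k ! j"
  shows "m * (k ! a * k ! c) \<le> cost A k"
proof (cases A)
  case (Mat j)
  then show ?thesis using assms factors_Mat_eq_upt by blast
next
  case (Mult B C)
  obtain b where b: "a < b" "b < c"
    and cost: "cost (Mult B C) k = cost B k + cost C k + k ! a * k ! b * k ! c"
    using factors_Mult_eq_upt assms(1) Mult by metis
  have "m * (k ! a * k ! c) \<le> k ! b * (k ! a * k ! c)"
    using b assms by (intro mult_right_mono) auto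
  also have "\<dots> = k ! a * k ! b * k ! c" by simp
  finally show ?thesis unfolding Mult cost by linarith
qed

lemma cost_ge_cube:
  fixes x :: nat
  assumes "factors A = [Suc a..<Suc c]" "Suc a < c"
    and "\<And>j. a \<le> j \<Longrightarrow> j \<le> c \<Longrightarrow> x \<le> k ! j"
  shows "x ^ 3 \<le> cost A k"
proof -
  have "x ^ 3 \<le> x * (k ! a * k ! c)"
    unfolding power3_eq_cube mult.assoc using assms by (intro mult_left_mono mult_mono) auto
  also have "\<dots> \<le> cost A k" using assms by (rule cost_ge_outer_edge)
  finally show ?thesis .
qed

section \<open>Orderings cheaper than a cube are fans\<close>

lemma R_ord_Suc: "h < n \<Longrightarrow> R_ord (Suc n) h = Mult (R_ord n h) (Mat (Suc n))"
  by (simp add: R_ord_def)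

text \<open>Only the dimension at \<open>a\<close> may be small. A right factor with two or more
  matrices would avoid \<open>a\<close> and already cost \<open>x ^ 3\<close>, so each right factor
  is a single matrix.\<close>

lemma cost_lt_cube_imp_R_ord:
  fixes x :: nat
  assumes "factors A = [Suc a..<Suc c]" "cost A k < x ^ 3"
    and "\<And>j. a < j \<Longrightarrow> j \<le> c \<Longrightarrow> x \<le> k ! j"
  shows "A = R_ord c a"
  using assms
proof (induction A arbitrary: c)
  case (Mat i)
  then show ?case using factors_Mat_eq_upt[OF Mat.prems(1)] by (simp add: R_ord_def)
next
  case (Mult B C)
  obtain b where b: "a < b" "b < c" "factors B = [Suc a..<Suc b]" "factors C = [Suc b..<Suc c]"
    and cost: "cost (Mult B C) k = cost B k + cost C k + k ! a * k ! b * k ! c"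
    using factors_Mult_eq_upt[OF Mult.prems(1)] by metis
  have "\<not> Suc b < c"
    using cost_ge_cube[OF b(4), of x k] b Mult.prems cost by fastforce
  then have c: "c = Suc b" using b by simp
  have "B = R_ord b a"
    using b Mult.prems cost by (intro Mult.IH(1)) auto
  moreover have "C = Mat c" using factors_eq_upt_singleton[OF b(4)] c by simp
  ultimately show ?case using b c by (simp add: R_ord_Suc)
qed

text \<open>Mirror image, with the small dimension at \<open>c\<close>. The conclusion uses
  \<open>foldr\<close> because \<open>L_ord\<close> always starts at matrix 1, whereas the induction
  moves the left end \<open>a\<close>.\<close>

lemma cost_lt_cube_imp_foldr:
  fixes x :: nat
  assumes "factors A = [Suc a..<Suc c]" "cost A k < x ^ 3"
    and "\<And>j. a \<le> j \<Longrightarrow> j < c \<Longrightarrow> x \<le> k ! j"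
  shows "A = foldr (\<lambda>i A. Mult (Mat i) A) [Suc a..<c] (Mat c)"
  using assms
proof (induction A arbitrary: a)
  case (Mat i)
  then show ?case using factors_Mat_eq_upt[OF Mat.prems(1)] by simp
next
  case (Mult B C)
  obtain b where b: "a < b" "b < c" "factors B = [Suc a..<Suc b]" "factors C = [Suc b..<Suc c]"
    and cost: "cost (Mult B C) k = cost B k + cost C k + k ! a * k ! b * k ! c"
    using factors_Mult_eq_upt[OF Mult.prems(1)] by metis
  have "\<not> Suc a < b"
    using cost_ge_cube[OF b(3), of x k] b Mult.prems cost by fastforce
  then have b': "b = Suc a" using b by simp
  have "C = foldr (\<lambda>i A. Mult (Mat i) A) [Suc b..<c] (Mat c)"
    using b Mult.prems cost by (intro Mult.IH(2)) auto
  moreover have "B = Mat b" using factors_eq_upt_singleton[OF b(3)] b' by simp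
  ultimately show ?case using b b' by (simp add: upt_conv_Cons)
qed

lemma cost_lt_cube_imp_E_ord:
  fixes x :: nat
  assumes A: "A \<in> orderings n" and lt: "cost A k < x ^ 3" and h: "h \<le> n"
    and x: "\<And>j. j \<le> n \<Longrightarrow> j \<noteq> h \<Longrightarrow> x \<le> k ! j"
  shows "A = E_ord n h"
proof -
  have fA: "factors A = [Suc 0..<Suc n]" using A by (simp add: orderings_def)
  consider "h = 0" | "h = n" "h \<noteq> 0" | "0 < h" "h < n" using h by linarith
  then show ?thesis
  proof cases
    case 1
    then show ?thesis using cost_lt_cube_imp_R_ord[OF fA lt] x by (simp add: E_ord_def)
  next
    case 2
    then show ?thesis using cost_lt_cube_imp_foldr[OF fA lt] x by (simp add: E_ord_def L_ord_def)
  next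
    case 3
    have "A \<noteq> Mat i" for i
      using fA factors_Mat_eq_upt(1)[of i 0 n] 3 by (auto simp del: upt_Suc)
    then obtain B C where ABC: "A = Mult B C" by (cases A) auto
    obtain b where b: "0 < b" "b < n" "factors B = [Suc 0..<Suc b]" "factors C = [Suc b..<Suc n]"
      and cost: "cost A k = cost B k + cost C k + k ! 0 * k ! b * k ! n"
      using factors_Mult_eq_upt fA unfolding ABC by metis
    \<comment> \<open>Otherwise the triangle on 0, \<open>b\<close>, \<open>n\<close> avoids
      \<open>h\<close> and alone costs \<open>x ^ 3\<close>.\<close>
    have "b = h"
    proof (rule ccontr)
      assume "b \<noteq> h"
      then have "x ^ 3 \<le> k ! 0 * k ! b * k ! n"
        unfolding power3_eq_cube using b 3 by (intro mult_mono x) auto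
      then show False using cost lt by linarith
    qed
    moreover have "B = L_ord h"
      using cost_lt_cube_imp_foldr[OF b(3), of k x] \<open>b = h\<close> cost lt x b
      by (simp add: L_ord_def)
    moreover have "C = R_ord n h"
      using cost_lt_cube_imp_R_ord[OF b(4), of k x] \<open>b = h\<close> cost lt x b by simp
    ultimately show ?thesis using 3 ABC by (simp add: E_ord_def)
  qed
qed

section \<open>The cost of a fan\<close>

lemma cost_L_ord: "cost (L_ord h) k = (\<Sum>i=1..<h. k ! (i - 1) * k ! i * k ! h)"
proof -
  let ?f = "\<lambda>i A. Mult (Mat i) A"
  have last: "last (factors (foldr ?f xs (Mat h))) = h" for xs
    by (induction xs) (auto simp: factors_nonempty)
  have "cost (foldr ?f xs (Mat h)) k = (\<Sum>i\<leftarrow>xs. k ! (i - 1) * k ! i * k ! h)" for xs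
    by (induction xs) (auto simp: last)
  then show ?thesis by (simp add: L_ord_def interv_sum_list_conv_sum_set_nat)
qed

lemma cost_R_ord:
  assumes "h < n"
  shows "cost (R_ord n h) k = (\<Sum>i=h+2..n. k ! h * k ! (i - 1) * k ! i)"
proof -
  from assms have "Suc h \<le> n" by simp
  then show ?thesis
  proof (induction n rule: dec_induct)
    case base
    then show ?case by (simp add: R_ord_def)
  next
    case (step n)
    then have "factors (R_ord n h) = [Suc h..<Suc n]" by (intro factors_R_ord) simp
    with step show ?case by (simp add: R_ord_Suc hd_upt last_upt del: upt_Suc)
  qed
qed

text \<open>Each of the \<open>n - 1\<close> triangles of the fan has apex \<open>h\<close> and a
  polygon edge as its opposite side, so \<open>D\<close> bounds each of them.\<close>

lemma cost_E_ord_le: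
  assumes "h \<le> n" "n \<ge> 1"
    and edge: "\<And>i. i < n \<Longrightarrow> k ! h * (k ! i * k ! Suc i) \<le> D"
    and outer: "k ! h * (k ! 0 * k ! n) \<le> D"
  shows "cost (E_ord n h) k \<le> n * D"
proof -
  have edge': "k ! h * (k ! (i - 1) * k ! i) \<le> D" if "1 \<le> i" "i \<le> n" for i
    using edge[of "i - 1"] that by simp
  have L: "cost (L_ord h) k \<le> (h - 1) * D"
  proof -
    have "cost (L_ord h) k \<le> (\<Sum>i=1..<h. D)"
      unfolding cost_L_ord using edge' assms(1) by (intro sum_mono) (auto simp: mult_ac)
    then show ?thesis by simp
  qed
  have R: "cost (R_ord n h) k \<le> (n - h - 1) * D" if "h < n"
  proof -
    have "cost (R_ord n h) k \<le> (\<Sum>i=h+2..n. D)"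
      unfolding cost_R_ord[OF that] using edge' by (intro sum_mono) (auto simp: mult_ac)
    then show ?thesis by simp
  qed
  consider "h = 0" | "h = n" "h \<noteq> 0" | "0 < h" "h < n" using assms by linarith
  then show ?thesis
  proof cases
    case 1
    then have "cost (E_ord n h) k \<le> (n - h - 1) * D" using R assms by (simp add: E_ord_def)
    also have "\<dots> \<le> n * D" by (intro mult_right_mono) auto
    finally show ?thesis .
  next
    case 2
    then have "cost (E_ord n h) k \<le> (h - 1) * D" using L by (simp add: E_ord_def)
    also have "\<dots> \<le> n * D" using assms by (intro mult_right_mono) auto
    finally show ?thesis .
  next
    case 3
    have facs: "factors (L_ord h) = [1..<Suc h]" "factors (R_ord n h) = [Suc h..<Suc n]"
      using 3 by (simp_all add: factors_L_ord factors_R_ord del: upt_Suc)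
    have "hd (factors (L_ord h)) = 1" "last (factors (L_ord h)) = h"
      "last (factors (R_ord n h)) = n"
      using 3 unfolding facs by (simp_all add: hd_upt last_upt del: upt_Suc)
    then have "cost (E_ord n h) k = cost (L_ord h) k + cost (R_ord n h) k + k ! h * (k ! 0 * k ! n)"
      using 3 by (simp add: E_ord_def)
    \<comment> \<open>The last summand is the triangle on 0, \<open>h\<close>, \<open>n\<close> of
      the final multiplication.\<close>
    also have "\<dots> \<le> (h - 1) * D + (n - h - 1) * D + 1 * D"
      using L R outer 3 by simp
    also have "\<dots> = ((h - 1) + (n - h - 1) + 1) * D"
      by (simp only: distrib_right)
    also have "\<dots> \<le> n * D" using 3 by (intro mult_right_mono) auto
    finally show ?thesis .
  qed
qed

lemma E_ord_in_orderings: "n \<ge> 1 \<Longrightarrow> h \<le> n \<Longrightarrow> E_ord n h \<in> orderings n"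
  using E_set_subset_orderings[of n] by (auto simp: E_set_def)

lemma min_cost_le: "finite S \<Longrightarrow> A \<in> S \<Longrightarrow> min_cost S k \<le> cost A k"
  unfolding min_cost_def by (intro Min_le) auto

lemma le_min_cost:
  "finite S \<Longrightarrow> S \<noteq> {} \<Longrightarrow> (\<And>A. A \<in> S \<Longrightarrow> d \<le> cost A k) \<Longrightarrow> d \<le> min_cost S k"
  unfolding min_cost_def by (intro Min.boundedI) auto

section \<open>Fans are essential\<close>

lemma E_ord_essential:
  assumes n: "n \<ge> 3" and h: "h \<le> n"
  shows "essential n (E_ord n h)"
  unfolding essential_def
proof (intro conjI allI impI)
  show E: "E_ord n h \<in> orderings n" using E_ord_in_orderings n h by simp
  fix r :: real assume "r > 0"
  \<comment> \<open>The ratio of the minima will be at least \<open>x ^ 3\<close> over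
    \<open>n * x\<^sup>2\<close>, that is, \<open>x\<close> over \<open>n\<close>, which has to
    exceed \<open>r + 1\<close>.\<close>
  define x where "x = Suc (nat \<lceil>n * (r + 1)\<rceil>)"
  have x: "n * (r + 1) < x" unfolding x_def by linarith
  have x1: "1 \<le> x" by (simp add: x_def)
  define k where "k = (replicate (Suc n) x)[h := 1]"
  have kh: "k ! h = 1" using h by (simp add: k_def del: replicate_Suc)
  have kj: "k ! j = x" if "j \<le> n" "j \<noteq> h" for j
    using that unfolding k_def by (simp del: replicate_Suc)
  have le_x: "k ! j \<le> x" if "j \<le> n" for j using kh kj that x1 by (cases "j = h") auto
  have ge1: "1 \<le> k ! j" if "j \<le> n" for j using kh kj that x1 by (cases "j = h") auto
  have "chain_instance n k"
    using ge1 by (auto simp: chain_instance_def Suc_le_eq) (simp add: k_def del: replicate_Suc)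
  moreover have "penalty n {E_ord n h} k > r"
  proof -
    let ?N = "min_cost (orderings n - {E_ord n h}) k" and ?D = "min_cost (orderings n) k"
    have "cost (E_ord n h) k \<le> n * x\<^sup>2"
      using n h by (intro cost_E_ord_le) (auto simp: kh power2_eq_square intro!: mult_mono le_x)
    then have D: "?D \<le> n * x\<^sup>2"
      using min_cost_le[OF finite_orderings E] by (rule order_trans[rotated])
    \<comment> \<open>A positive optimum permits clearing the denominator of the penalty; it follows
      from the cube bound with all dimensions at least 1.\<close>
    have "1 \<le> ?D"
    proof (rule le_min_cost[OF finite_orderings])
      show "orderings n \<noteq> {}" using E by auto
      fix A assume "A \<in> orderings n"
      then have "1 ^ 3 \<le> cost A k"
        using n ge1 by (intro cost_ge_cube[of A 0 n]) (auto simp: orderings_def)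
      then show "1 \<le> cost A k" by simp
    qed
    have N: "x ^ 3 \<le> ?N"
    proof (rule le_min_cost)
      show "finite (orderings n - {E_ord n h})" by (simp add: finite_orderings)
      show "orderings n - {E_ord n h} \<noteq> {}" using n by (rule orderings_remove1_nonempty)
      fix A assume "A \<in> orderings n - {E_ord n h}"
      then show "x ^ 3 \<le> cost A k"
        using cost_lt_cube_imp_E_ord[of A n k x h] h kj by (auto simp: not_less[symmetric])
    qed
    have "(r + 1) * ?D \<le> (r + 1) * real (n * x\<^sup>2)"
      using D \<open>r > 0\<close> by (intro mult_left_mono) (auto simp flip: of_nat_power of_nat_mult)
    also have "\<dots> = (n * (r + 1)) * real (x\<^sup>2)" by simp
    also have "\<dots> < real x * real (x\<^sup>2)"
      using x x1 by (intro mult_strict_right_mono) auto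
    also have "\<dots> = real (x ^ 3)" by (simp add: power3_eq_cube power2_eq_square)
    also have "\<dots> \<le> real ?N" using N by (simp only: of_nat_le_iff)
    finally show ?thesis using \<open>1 \<le> ?D\<close> by (simp add: penalty_def field_simps)
  qed
  ultimately show "\<exists>k. chain_instance n k \<and> penalty n {E_ord n h} k > r" by blast
qed

section \<open>Other orderings are not essential\<close>

lemma ex_E_ord_cost_le:
  assumes n: "n \<ge> 2"
  obtains h where "h \<le> n" "\<And>A. A \<in> orderings n \<Longrightarrow> cost (E_ord n h) k \<le> n * cost A k"
proof -
  \<comment> \<open>With a minimal dimension at \<open>h\<close>, every triangle on a polygon edge
    costs at least as much as the fan's triangle on that edge.\<close>
  define h where "h = arg_min_on (\<lambda>j. k ! j) {..n}"
  have h: "h \<le> n"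
    using arg_min_if_finite(1)[of "{..n}" "\<lambda>j. k ! j"] by (auto simp: h_def)
  have min: "k ! h \<le> k ! j" if "j \<le> n" for j
    unfolding h_def using that by (intro arg_min_least) auto
  have "cost (E_ord n h) k \<le> n * cost A k" if "A \<in> orderings n" for A
  proof (rule cost_E_ord_le)
    have A: "factors A = [Suc 0..<Suc n]" using that by (simp add: orderings_def)
    show "k ! h * (k ! i * k ! Suc i) \<le> cost A k" if "i < n" for i
      using A n that min by (intro cost_ge_edge[of A 0 n]) auto
    show "k ! h * (k ! 0 * k ! n) \<le> cost A k"
      using A n min by (intro cost_ge_outer_edge[of A 0 n]) auto
  qed (use n h in auto)
  with h show thesis using that by blast
qed

lemma not_essential_if_not_E_set:
  assumes n: "n \<ge> 2" and A: "A \<notin> E_set n"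
  shows "\<not> essential n A"
proof
  assume "essential n A"
  \<comment> \<open>Essentiality is used at \<open>r = n\<close>, which the fan at a minimal vertex
    of \<open>k\<close> will contradict.\<close>
  then obtain k where pen: "penalty n {A} k > n"
    using n unfolding essential_def
    by (metis of_nat_0_less_iff pos2 order_less_le_trans)
  obtain h where h: "h \<le> n" and le: "\<And>B. B \<in> orderings n \<Longrightarrow> cost (E_ord n h) k \<le> n * cost B k"
    using ex_E_ord_cost_le[OF n] by metis
  have E: "E_ord n h \<in> orderings n - {A}"
    using E_ord_in_orderings[of n h] n h A by (auto simp: E_set_def)
  have "min_cost (orderings n) k \<in> (\<lambda>B. cost B k) ` orderings n"
    unfolding min_cost_def using finite_orderings E by (intro Min_in) auto
  then obtain B where B: "B \<in> orderings n" "min_cost (orderings n) k = cost B k" by auto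
  have "min_cost (orderings n - {A}) k \<le> cost (E_ord n h) k"
    using E by (intro min_cost_le) (auto simp: finite_orderings)
  also have "\<dots> \<le> n * min_cost (orderings n) k" using le B by simp
  finally have "real (min_cost (orderings n - {A}) k) \<le> real n * real (min_cost (orderings n) k)"
    by (simp flip: of_nat_mult)
  then have "penalty n {A} k \<le> n"
    \<comment> \<open>If the denominator is 0, division yields 0 and the penalty is -1.\<close>
    by (cases "min_cost (orderings n) k = 0") (auto simp: penalty_def field_simps)
  with pen show False by simp
qed

theorem theorem5p4:
  fixes n :: nat
  assumes "n \<ge> 3"
  shows "(\<forall>A\<in>E_set n. essential n A) \<and> (\<forall>A\<in>orderings n - E_set n. \<not> essential n A)"
  using assms E_ord_essential not_essential_if_not_E_set by (auto simp: E_set_def)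

end
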